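(* Consider a $p$-value family $(p_i(X))_{1\le i\le m}$ for which there is a family of variables $(q_i(X))_{1\leq i\leq m}$ such that for all $P\in\mathcal{P}$: (a) for all $i\in\mathcal{H}_0(P)$, $p_i(X)\geq q_i(X)$ $P$-almost surely; (b) the joint distribution $\nu_m$ of $(q_i(X))_{1\leq i\leq m}$ does not depend on $P$. Consider a deterministic template $t_k(\lambda)$, $\lambda\in[0,1]$, $1\leq k\leq K$, and the associated reference families $\mathfrak{R}_\lambda$. Define, for $\alpha\in(0,1)$ and $A\subset\mathbb{N}_m$, $$\lambda(\alpha,A)=\max\Big\{\lambda\in[0,1]:\ \mathbb{P}_{q\sim\nu_m}\Big(\min_{1\leq k\leq K\wedge|A|}\big\{t_k^{-1}\big(q_{(k:A)}\big)\big\}<\lambda\Big)\leq\alpha\Big\}.$$ Then the (deterministic) functional $\lambda(\cdot,\cdot)$ is a $\lambda$-calibration. Consequently, for every $\alpha\in(0,1)$, $\mathfrak{R}_{\lambda(\alpha,\mathbb{N}_m)}$ and $\mathfrak{R}_{\lambda(\alpha,\widehat{A})}$ both control the JER at level $\alpha$: for all $P\in\mathcal{P}$, $\mathrm{JER}(\mathfrak{R}_{\lambda(\alpha,\mathbb{N}_m)},P)\leq\alpha$ and $\mathrm{JER}(\mathfrak{R}_{\lambda(\alpha,\widehat{A})},P)\leq\alpha$, where $\widehat{A}$ is the output of the step-down algorithm run with $\lambda(\cdot,\cdot)$.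
   Context: $X$ is an observation with distribution $P$ belonging to a statistical model $\mathcal{P}$; $\mathbb{N}_m=\{1,\dots,m\}$ indexes null hypotheses $H_{0,i}\subset\mathcal{P}$; $\mathcal{H}_0=\mathcal{H}_0(P)=\{i\in\mathbb{N}_m: P\in H_{0,i}\}$ and $m_0=m_0(P)=|\mathcal{H}_0(P)|$. For each $i$, $p_i(X)\in[0,1]$ is a $p$-value for $H_{0,i}$. The $q_i(X)$ are real random variables, a purely technical device: they need not be observable and may involve the unknown parameters of $P$. For $A\subset\mathbb{N}_m$ and $1\le k\le|A|$, $p_{(k:A)}(X)$ (resp. $q_{(k:A)}$) is the $k$-th smallest value among $\{p_i(X), i\in A\}$ (resp. $\{q_i, i\in A\}$). Minima over an empty index set equal $+\infty$; $a\wedge b=\min(a,b)$. Template: a family of functions $t_k(\lambda)$, $\lambda\in[0,1]$, $1\leq k\leq K$, with $K\in\{1,\dots,m\}$ fixed, such that for all $k$, $t_k(0)=0$ and $t_k(\cdot)$ is non-decreasing and left-continuous on $[0,1]$. Generalized inverse: $t_k^{-1}(y)=\max\{x\in[0,1]: t_k(x)\leq y\}$, set to $0$ if $y<0$. Reference family: for $\lambda\in[0,1]$ (possibly data-dependent), $\mathfrak{R}_\lambda=(R_1(X),\dots,R_K(X))$ with $R_k(X)=\{i\in\mathbb{N}_m: p_i(X)<t_k(\lambda)\}$. The joint family-wise error rate of a family $\mathfrak{R}=(R_1(X),\dots,R_K(X))$ is $$\mathrm{JER}(\mathfrak{R},P)=1-\mathbb{P}_{X\sim P}\big(\forall k\in\{1,\dots,K\}:\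 |R_k(X)\cap\mathcal{H}_0(P)|\leq k-1\big).$$ $\lambda$-calibration: a (possibly data-dependent) functional $\lambda(\alpha,A)\in[0,1]$, $\alpha\in(0,1)$, $A\subset\mathbb{N}_m$, such that (i) for all $\alpha\in(0,1)$ and $A\subset A'\subset\mathbb{N}_m$, $\lambda(\alpha,A')\leq\lambda(\alpha,A)$; and (ii) for all $\alpha\in(0,1)$ and $P\in\mathcal{P}$, $$\mathbb{P}_{X\sim P}\Big(\min_{1\leq k\leq K\wedge m_0}\big\{t_k^{-1}\big(p_{(k:\mathcal{H}_0(P))}(X)\big)\big\}<\lambda(\alpha,\mathcal{H}_0(P))\Big)\leq\alpha.$$ Step-down algorithm (given $\alpha$, a template and a functional $\lambda(\cdot,\cdot)$): set $A^{(0)}=\mathbb{N}_m$; for $j=1,2,\dots$ set $\lambda_j=\lambda(\alpha,A^{(j-1)})$ and $A^{(j)}=\{i\in\mathbb{N}_m:\ p_i(X)\geq t_1(\lambda_j)\}$; stop at the first $j\geq1$ such that $A^{(j)}=A^{(j-1)}$ and return $\widehat{A}=A^{(j)}$. *)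

theory Defs
  imports "HOL-Probability.Probability"
begin

text \<open>
  The observation takes values in a measurable space \<open>S\<close>; the statistical model is a set of
  probability measures \<open>P\<close> on \<open>S\<close>, and statistics are functions of the outcome \<open>x\<close>. Hypotheses are
  indexed by \<open>{1..m}\<close>, and \<open>H i\<close> is the set of those \<open>P\<close> satisfying the \<open>i\<close>-th null hypothesis.
\<close>

definition true_nulls :: "nat \<Rightarrow> (nat \<Rightarrow> 'x measure set) \<Rightarrow> 'x measure \<Rightarrow> nat set" where
  "true_nulls m H P = {i \<in> {1..m}. P \<in> H i}"

text \<open>Order statistics are taken with multiplicity; \<open>k\<close> ranges over \<open>1 \<le> k \<le> card A\<close>.\<close>

definition kth_smallest :: "nat \<Rightarrow> nat set \<Rightarrow> (nat \<Rightarrow> real) \<Rightarrow> real" where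
  "kth_smallest k A f = sorted_list_of_multiset (image_mset f (mset_set A)) ! (k - 1)"

text \<open>Only the values of a template on \<open>{0..1}\<close> matter; left-continuity is void at \<open>0\<close>.\<close>

definition is_template :: "nat \<Rightarrow> (nat \<Rightarrow> real \<Rightarrow> real) \<Rightarrow> bool" where
  "is_template K t \<longleftrightarrow>
     (\<forall>k\<in>{1..K}. t k 0 = 0 \<and> mono_on {0..1} (t k) \<and> (\<forall>x\<in>{0<..1}. continuous (at_left x) (t k)))"

text \<open>
  Maxima over subsets of \<open>[0,1]\<close> are written with \<^const>\<open>Greatest\<close>, since \<^const>\<open>Max\<close> is only
  meaningful for finite sets. Here the maximum is attained because of left-continuity.
\<close>

definition gen_inv :: "(real \<Rightarrow> real) \<Rightarrow> real \<Rightarrow> real" where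
  "gen_inv f y = (if y < 0 then 0 else (GREATEST x. x \<in> {0..1} \<and> f x \<le> y))"

text \<open>
  \<open>\<min>\<^bsub>1 \<le> k \<le> K \<and> |A|\<^esub> t\<^sub>k\<^sup>-\<^sup>1(f\<^bsub>(k:A)\<^esub>)\<close>, extended-real valued so that the minimum over
  no indices is \<open>+\<infinity>\<close>.
\<close>

definition min_stat :: "nat \<Rightarrow> (nat \<Rightarrow> real \<Rightarrow> real) \<Rightarrow> nat set \<Rightarrow> (nat \<Rightarrow> real) \<Rightarrow> ereal" where
  "min_stat K t A f = (INF k\<in>{1..min K (card A)}. ereal (gen_inv (t k) (kth_smallest k A f)))"

definition ref_family ::
  "nat \<Rightarrow> (nat \<Rightarrow> 'x \<Rightarrow> real) \<Rightarrow> (nat \<Rightarrow> real \<Rightarrow> real) \<Rightarrow> ('x \<Rightarrow> real) \<Rightarrow> nat \<Rightarrow> 'x \<Rightarrow> nat set" where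
  "ref_family m p t l k x = {i \<in> {1..m}. p i x < t k (l x)}"

definition JER ::
  "nat \<Rightarrow> (nat \<Rightarrow> 'x measure set) \<Rightarrow> nat \<Rightarrow> (nat \<Rightarrow> 'x \<Rightarrow> nat set) \<Rightarrow> 'x measure \<Rightarrow> real" where
  "JER m H K R P =
     1 - measure P {x \<in> space P. \<forall>k\<in>{1..K}. card (R k x \<inter> true_nulls m H P) \<le> k - 1}"

text \<open>
  A possibly data-dependent functional \<open>l \<alpha> A x\<close>. Measurability in \<open>x\<close> is part of the notion of
  data-dependent quantity, so that the probability in the last clause is meaningful.
\<close>

definition lambda_calibration ::
  "'x measure \<Rightarrow> 'x measure set \<Rightarrow> nat \<Rightarrow> (nat \<Rightarrow> 'x measure set) \<Rightarrow> (nat \<Rightarrow> 'x \<Rightarrow> real) \<Rightarrow>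
   nat \<Rightarrow> (nat \<Rightarrow> real \<Rightarrow> real) \<Rightarrow> (real \<Rightarrow> nat set \<Rightarrow> 'x \<Rightarrow> real) \<Rightarrow> bool" where
  "lambda_calibration S \<P> m H p K t l \<longleftrightarrow>
     (\<forall>\<alpha>\<in>{0<..<1}. \<forall>A\<subseteq>{1..m}. l \<alpha> A \<in> borel_measurable S \<and> (\<forall>x\<in>space S. l \<alpha> A x \<in> {0..1})) \<and>
     (\<forall>\<alpha>\<in>{0<..<1}. \<forall>A A'. A \<subseteq> A' \<and> A' \<subseteq> {1..m} \<longrightarrow> (\<forall>x\<in>space S. l \<alpha> A' x \<le> l \<alpha> A x)) \<and>
     (\<forall>\<alpha>\<in>{0<..<1}. \<forall>P\<in>\<P>.
        measure P {x \<in> space P.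
          min_stat K t (true_nulls m H P) (\<lambda>i. p i x) < ereal (l \<alpha> (true_nulls m H P) x)} \<le> \<alpha>)"

fun step_down_set ::
  "nat \<Rightarrow> (nat \<Rightarrow> 'x \<Rightarrow> real) \<Rightarrow> (nat \<Rightarrow> real \<Rightarrow> real) \<Rightarrow> (real \<Rightarrow> nat set \<Rightarrow> 'x \<Rightarrow> real) \<Rightarrow>
   real \<Rightarrow> 'x \<Rightarrow> nat \<Rightarrow> nat set" where
  "step_down_set m p t l \<alpha> x 0 = {1..m}"
| "step_down_set m p t l \<alpha> x (Suc j) =
     {i \<in> {1..m}. p i x \<ge> t 1 (l \<alpha> (step_down_set m p t l \<alpha> x j) x)}"

definition step_down ::
  "nat \<Rightarrow> (nat \<Rightarrow> 'x \<Rightarrow> real) \<Rightarrow> (nat \<Rightarrow> real \<Rightarrow> real) \<Rightarrow> (real \<Rightarrow> nat set \<Rightarrow> 'x \<Rightarrow> real) \<Rightarrow>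
   real \<Rightarrow> 'x \<Rightarrow> nat set" where
  "step_down m p t l \<alpha> x =
     step_down_set m p t l \<alpha> x
       (LEAST j. 1 \<le> j \<and> step_down_set m p t l \<alpha> x j = step_down_set m p t l \<alpha> x (j - 1))"

text \<open>Joint law, under \<open>P\<close>, of \<open>(q\<^sub>1, \<dots>, q\<^sub>m)\<close> on \<open>\<real>\<^sup>m\<close>, realized as a product space.\<close>

definition joint_law :: "nat \<Rightarrow> (nat \<Rightarrow> 'x \<Rightarrow> real) \<Rightarrow> 'x measure \<Rightarrow> (nat \<Rightarrow> real) measure" where
  "joint_law m q P = distr P (\<Pi>\<^sub>M i\<in>{1..m}. borel) (\<lambda>x. \<lambda>i\<in>{1..m}. q i x)"

definition lambda_nu ::
  "(nat \<Rightarrow> real) measure \<Rightarrow> nat \<Rightarrow> (nat \<Rightarrow> real \<Rightarrow> real) \<Rightarrow> real \<Rightarrow> nat set \<Rightarrow> real" where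
  "lambda_nu \<nu> K t \<alpha> A =
     (GREATEST l. l \<in> {0..1} \<and> measure \<nu> {w \<in> space \<nu>. min_stat K t A w < ereal l} \<le> \<alpha>)"

end

theory Submission imports Defs "HOL-Real_Asymp.Real_Asymp" begin

text \<open>
  By left-continuity of the template, for \<open>0 < l \<le> 1\<close> the inequality \<open>t\<^sub>k\<^sup>-\<^sup>1(y) < l\<close> is equivalent to
  \<open>y < t\<^sub>k(l)\<close>. Hence the event that the minimum statistic of \<open>A\<close> falls below \<open>l\<close> says that for some
  \<open>k \<le> K\<close> at least \<open>k\<close> of the variables indexed by \<open>A\<close> lie below \<open>t\<^sub>k(l)\<close>
  (\<open>min_stat_less_iff\<close>). In this form the event visibly grows with \<open>A\<close> and with \<open>l\<close>, and
  shrinks when the variables increase. Monotonicity in \<open>A\<close> makes the calibrated level antitone in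
  \<open>A\<close>. Comparing the \<open>p\<^sub>i\<close> with the smaller \<open>q\<^sub>i\<close>, whose joint law is \<open>\<nu>\<close>, bounds the probability
  that the minimum statistic of the true nulls is below its calibrated level; the bound holds at
  the maximal level itself because, with \<open>M\<close> the minimum statistic, \<open>l \<mapsto> \<nu>(M < l)\<close> is left-continuous
  (\<open>lambda_nu_props\<close>).

  Outside that event of probability at most \<open>\<alpha>\<close>, no level \<open>l\<close> up to the calibrated level of the true nulls
  leads to a violation: for every \<open>k\<close>, fewer than \<open>k\<close> true nulls have a \<open>p\<close>-value below \<open>t\<^sub>k(l)\<close>
  (\<open>many_small_imp_min_stat_less\<close>). The level of \<open>{1..m}\<close> is such an \<open>l\<close>. For the step-down
  procedure, the case \<open>k = 1\<close> shows by induction that every iterate contains all true nulls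
  (\<open>step_down_set_superset\<close>), so the level of its output is again such an \<open>l\<close>.
\<close>

section \<open>Maxima over the unit interval\<close>

text \<open>
  A downward closed condition on \<open>[0,1]\<close> that passes to limits from the left holds exactly up to
  its greatest witness.
\<close>

lemma Greatest_unit_interval:
  fixes Q :: "real \<Rightarrow> bool"
  assumes zero: "Q 0"
    and down: "\<And>x y. 0 \<le> x \<Longrightarrow> x \<le> y \<Longrightarrow> y \<le> 1 \<Longrightarrow> Q y \<Longrightarrow> Q x"
    and left: "\<And>s. 0 < s \<Longrightarrow> s \<le> 1 \<Longrightarrow> (\<And>x. 0 \<le> x \<Longrightarrow> x < s \<Longrightarrow> Q x) \<Longrightarrow> Q s"
  shows "(GREATEST x. x \<in> {0..1} \<and> Q x) \<in> {0..1}"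
    and "x \<in> {0..1} \<Longrightarrow> Q x \<longleftrightarrow> x \<le> (GREATEST x. x \<in> {0..1} \<and> Q x)"
proof -
  define s where "s = Sup {x \<in> {0..1}. Q x}"
  have bdd: "bdd_above {x \<in> {0..1}. Q x}"
    by (rule bdd_aboveI[of _ 1]) auto
  have upper: "x \<le> s" if "x \<in> {0..1}" "Q x" for x
    unfolding s_def by (rule cSup_upper[OF _ bdd]) (use that in auto)
  have s01: "s \<in> {0..1}"
  proof -
    have "0 \<in> {x \<in> {0..1}. Q x}" using zero by simp
    then have "{x \<in> {0..1}. Q x} \<noteq> {}" by blast
    then have "s \<le> 1" unfolding s_def by (rule cSup_least) auto
    then show ?thesis using upper[of 0] zero by simp
  qed
  have Qs: "Q s"
  proof (cases "s = 0")
    case False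
    have "Q x" if x: "0 \<le> x" "x < s" for x
    proof -
      have "0 \<in> {x \<in> {0..1}. Q x}" using zero by simp
      then have "{x \<in> {0..1}. Q x} \<noteq> {}" by blast
      then obtain y where "y \<in> {0..1}" "Q y" "x < y"
        using x(2) less_cSup_iff[OF _ bdd] unfolding s_def by auto
      then show ?thesis using down[of x y] x by auto
    qed
    then show ?thesis using left[of s] s01 False by auto
  qed (use zero in simp)
  have eq: "(GREATEST x. x \<in> {0..1} \<and> Q x) = s"
    by (rule Greatest_equality) (use s01 Qs upper in auto)
  show "(GREATEST x. x \<in> {0..1} \<and> Q x) \<in> {0..1}" using eq s01 by simp
  show "Q x \<longleftrightarrow> x \<le> (GREATEST x. x \<in> {0..1} \<and> Q x)" if "x \<in> {0..1}"
    unfolding eq using that upper down[of x s] Qs s01 by auto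
qed

lemma is_templateD:
  assumes "is_template K t" "k \<in> {1..K}"
  shows "t k 0 = 0" "\<And>x y. 0 \<le> x \<Longrightarrow> x \<le> y \<Longrightarrow> y \<le> 1 \<Longrightarrow> t k x \<le> t k y"
    "\<And>x. 0 < x \<Longrightarrow> x \<le> 1 \<Longrightarrow> continuous (at_left x) (t k)"
  using assms by (auto simp: is_template_def mono_on_def)

text \<open>The Galois connection between a template function and its generalized inverse.\<close>

lemma template_le_iff_le_gen_inv:
  assumes T: "is_template K t" "k \<in> {1..K}" and y: "0 \<le> y"
  shows "gen_inv (t k) y \<in> {0..1}"
    and "x \<in> {0..1} \<Longrightarrow> t k x \<le> y \<longleftrightarrow> x \<le> gen_inv (t k) y"
proof -
  note td = is_templateD[OF T]
  have left: "t k s \<le> y" if s: "0 < s" "s \<le> 1" "\<And>x. 0 \<le> x \<Longrightarrow> x < s \<Longrightarrow> t k x \<le> y" for s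
  proof (rule tendsto_upperbound)
    show "(t k \<longlongrightarrow> t k s) (at_left s)"
      using td(3)[OF s(1,2)] by (simp add: continuous_within)
    show "\<forall>\<^sub>F x in at_left s. t k x \<le> y"
      using eventually_at_left_real[OF s(1)] by eventually_elim (use s(3) in auto)
  qed simp
  have g: "gen_inv (t k) y = (GREATEST x. x \<in> {0..1} \<and> t k x \<le> y)"
    using y by (simp add: gen_inv_def)
  have zero: "t k 0 \<le> y" using td(1) y by simp
  have down: "t k x \<le> y" if "0 \<le> x" "x \<le> z" "z \<le> 1" "t k z \<le> y" for x z
    using td(2)[of x z] that by linarith
  show "gen_inv (t k) y \<in> {0..1}"
    unfolding g
    by (rule Greatest_unit_interval(1)[of "\<lambda>x. t k x \<le> y"]) (fact zero down left)+
  show "t k x \<le> y \<longleftrightarrow> x \<le> gen_inv (t k) y" if "x \<in> {0..1}"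
    unfolding g
    by (rule Greatest_unit_interval(2)[of "\<lambda>x. t k x \<le> y"]) (fact zero down left that)+
qed

lemma gen_inv_nonneg:
  assumes "is_template K t" "k \<in> {1..K}"
  shows "0 \<le> gen_inv (t k) y"
  using template_le_iff_le_gen_inv(1)[OF assms, of y] by (cases "y < 0") (auto simp: gen_inv_def)

lemma gen_inv_less_iff:
  assumes T: "is_template K t" "k \<in> {1..K}" and l: "0 < l" "l \<le> 1"
  shows "gen_inv (t k) y < l \<longleftrightarrow> y < t k l"
proof (cases "y < 0")
  case True
  then show ?thesis
    using is_templateD(1)[OF T] is_templateD(2)[OF T, of 0 l] l by (auto simp: gen_inv_def)
next
  case False
  then show ?thesis
    using template_le_iff_le_gen_inv(2)[OF T, of y l] l by (auto simp: not_le[symmetric])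
qed

section \<open>Order statistics and the minimum statistic\<close>

lemma sorted_nth_less_iff:
  fixes xs :: "real list"
  assumes "sorted xs" "j < length xs"
  shows "xs ! j < y \<longleftrightarrow> j < length (filter (\<lambda>x. x < y) xs)"
  using assms
proof (induction xs arbitrary: j)
  case (Cons a xs)
  show ?case
  proof (cases "a < y")
    case True
    then show ?thesis using Cons by (cases j) auto
  next
    case False
    then have "filter (\<lambda>x. x < y) (a # xs) = []"
      using Cons.prems(1) by (auto simp: filter_empty_conv)
    moreover have "a \<le> (a # xs) ! j"
      using Cons.prems nth_mem[of j "a # xs"] by auto
    ultimately show ?thesis using False by simp
  qed
qed simp

lemma kth_smallest_less_iff:
  assumes "finite A" "1 \<le> k" "k \<le> card A"
  shows "kth_smallest k A f < y \<longleftrightarrow> k \<le> card {i \<in> A. f i < y}"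
proof -
  define xs where "xs = sorted_list_of_multiset (image_mset f (mset_set A))"
  have ms: "mset xs = image_mset f (mset_set A)" by (simp add: xs_def)
  have "length xs = size (mset xs)" by simp
  also have "\<dots> = card A" by (simp only: ms size_image_mset size_mset_set)
  finally have len: "length xs = card A" .
  have "length (filter (\<lambda>x. x < y) xs) = size (filter_mset (\<lambda>x. x < y) (mset xs))"
    by (simp flip: mset_filter)
  also have "\<dots> = card {i \<in> A. f i < y}"
    using assms(1) by (simp add: ms filter_mset_image_mset filter_mset_mset_set)
  finally have "length (filter (\<lambda>x. x < y) xs) = card {i \<in> A. f i < y}" .
  moreover have "sorted xs" by (simp add: xs_def)
  ultimately show ?thesis
    using sorted_nth_less_iff[of xs "k - 1" y] assms len
    unfolding kth_smallest_def xs_def[symmetric] by auto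
qed

lemma min_stat_less_iff:
  assumes T: "is_template K t" and A: "finite A" and l: "0 < l" "l \<le> 1"
  shows "min_stat K t A f < ereal l \<longleftrightarrow> (\<exists>k\<in>{1..K}. k \<le> card {i \<in> A. f i < t k l})"
    (is "?L \<longleftrightarrow> ?R")
proof -
  have "?L \<longleftrightarrow> (\<exists>k\<in>{1..min K (card A)}. gen_inv (t k) (kth_smallest k A f) < l)"
    by (simp add: min_stat_def INF_less_iff)
  also have "\<dots> \<longleftrightarrow> (\<exists>k\<in>{1..min K (card A)}. k \<le> card {i \<in> A. f i < t k l})"
    using gen_inv_less_iff[OF T _ l] kth_smallest_less_iff[OF A] by (intro bex_cong) auto
  also have "\<dots> \<longleftrightarrow> ?R"
  proof -
    have "card {i \<in> A. f i < t k l} \<le> card A" for k using A by (intro card_mono) auto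
    then have "k \<le> card {i \<in> A. f i < t k l} \<Longrightarrow> k \<le> card A" for k by (rule order_trans[rotated])
    then show ?thesis by force
  qed
  finally show ?thesis .
qed

lemma min_stat_nonneg:
  assumes "is_template K t"
  shows "0 \<le> min_stat K t A f"
  unfolding min_stat_def using gen_inv_nonneg[OF assms] by (intro INF_greatest) simp

lemma min_stat_less_0: "is_template K t \<Longrightarrow> \<not> min_stat K t A f < ereal 0"
  using min_stat_nonneg[of K t A f] by (simp add: not_less zero_ereal_def)

lemma min_stat_less_mono:
  assumes T: "is_template K t" and A: "A \<subseteq> A'" "finite A'" and l: "0 \<le> l" "l \<le> 1"
    and fg: "\<And>i. i \<in> A \<Longrightarrow> g i \<le> f i" and less: "min_stat K t A f < ereal l"
  shows "min_stat K t A' g < ereal l"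
proof (cases "l = 0")
  case True
  then show ?thesis using less min_stat_less_0[OF T] by auto
next
  case False
  have fin: "finite A" using A by (rule finite_subset)
  obtain k where k: "k \<in> {1..K}" "k \<le> card {i \<in> A. f i < t k l}"
    using less min_stat_less_iff[OF T fin] l False by auto
  have "card {i \<in> A. f i < t k l} \<le> card {i \<in> A'. g i < t k l}"
    using A fg by (intro card_mono) (auto intro: le_less_trans)
  with k(2) have "k \<le> card {i \<in> A'. g i < t k l}" by (rule order_trans)
  with k(1) have "\<exists>k\<in>{1..K}. k \<le> card {i \<in> A'. g i < t k l}" ..
  then show ?thesis using min_stat_less_iff[OF T A(2)] l False by simp
qed

text \<open>
  Nonnegativity of the variables matters when \<open>l' = 0\<close>: the minimum statistic is then never below
  \<open>l'\<close>, and the hypothesis has to fail because no variable lies below \<open>t\<^sub>k(0) = 0\<close>.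
\<close>

lemma many_small_imp_min_stat_less:
  assumes T: "is_template K t" and A: "finite A" and l: "0 \<le> l" "l \<le> l'" "l' \<le> 1"
    and pos: "\<And>i. i \<in> A \<Longrightarrow> 0 \<le> f i"
    and k: "k \<in> {1..K}" "k \<le> card {i \<in> A. f i < t k l}"
  shows "min_stat K t A f < ereal l'"
proof (cases "l' = 0")
  case True
  then have "{i \<in> A. f i < t k l} = {}" using l pos is_templateD(1)[OF T k(1)] by force
  then have "card {i \<in> A. f i < t k l} = 0" by (simp only: card.empty)
  then show ?thesis using k by simp
next
  case False
  have "card {i \<in> A. f i < t k l} \<le> card {i \<in> A. f i < t k l'}"
    using A is_templateD(2)[OF T k(1) l] by (intro card_mono) auto
  with k(2) have "k \<le> card {i \<in> A. f i < t k l'}" by (rule order_trans)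
  with k(1) have "\<exists>k\<in>{1..K}. k \<le> card {i \<in> A. f i < t k l'}" ..
  then show ?thesis using min_stat_less_iff[OF T A] l False by simp
qed

section \<open>Measurability\<close>

text \<open>The condition is a finite disjunction over the subsets of \<open>A\<close> with at least \<open>k\<close> elements.\<close>

lemma pred_le_card:
  assumes "finite A" and meas: "\<And>i. i \<in> A \<Longrightarrow> Measurable.pred M (Q i)"
  shows "Measurable.pred M (\<lambda>x. k \<le> card {i \<in> A. Q i x})"
proof -
  have "k \<le> card {i \<in> A. Q i x} \<longleftrightarrow> (\<exists>B\<in>{B. B \<subseteq> A \<and> k \<le> card B}. \<forall>i\<in>B. Q i x)"
    (is "?L \<longleftrightarrow> ?R") for x
  proof
    assume ?L
    then show ?R by (intro bexI[of _ "{i \<in> A. Q i x}"]) auto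
  next
    assume ?R
    then obtain B where B: "k \<le> card B" "B \<subseteq> {i \<in> A. Q i x}" by blast
    then have "card B \<le> card {i \<in> A. Q i x}" using assms(1) by (intro card_mono) auto
    with B(1) show ?L by simp
  qed
  moreover have "Measurable.pred M (\<lambda>x. \<exists>B\<in>{B. B \<subseteq> A \<and> k \<le> card B}. \<forall>i\<in>B. Q i x)"
    using assms
    by (intro pred_intros_finite) (auto intro: finite_subset[OF _ assms(1)])
  ultimately show ?thesis by simp
qed

lemma pred_min_stat_less:
  assumes T: "is_template K t" and A: "finite A" and l: "l \<in> {0..1}"
    and [measurable]: "\<And>i. i \<in> A \<Longrightarrow> (\<lambda>x. f x i) \<in> borel_measurable M"
  shows "Measurable.pred M (\<lambda>x. min_stat K t A (f x) < ereal l)"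
proof (cases "l = 0")
  case True
  then show ?thesis using min_stat_less_0[OF T] by simp
next
  case False
  then have l': "0 < l" "l \<le> 1" using l by auto
  show ?thesis
    unfolding min_stat_less_iff[OF T A l']
    by (intro pred_intros_finite pred_le_card) (use A in auto)
qed

section \<open>The calibrated level\<close>

text \<open>
  The maximum defining the calibrated level is attained, and the levels meeting the bound are exactly
  those up to it. Writing \<open>M\<close> for the minimum statistic of \<open>A\<close>, the bound passes to
  limits from the left since \<open>{M < s}\<close> is the increasing union of
  the events \<open>{M < u\<^sub>n}\<close> when \<open>u\<^sub>n\<close> increases to \<open>s\<close> from below.
\<close>

lemma lambda_nu_props:
  fixes \<nu> :: "(nat \<Rightarrow> real) measure"
  assumes nu: "prob_space \<nu>" "sets \<nu> = sets (\<Pi>\<^sub>M i\<in>{1..m}. borel)"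
    and T: "is_template K t" and A: "A \<subseteq> {1..m}" and \<alpha>: "0 \<le> \<alpha>"
  shows "lambda_nu \<nu> K t \<alpha> A \<in> {0..1}"
    and "l \<in> {0..1} \<Longrightarrow>
      measure \<nu> {w \<in> space \<nu>. min_stat K t A w < ereal l} \<le> \<alpha> \<longleftrightarrow> l \<le> lambda_nu \<nu> K t \<alpha> A"
proof -
  interpret prob_space \<nu> by fact
  define E where "E l = {w \<in> space \<nu>. min_stat K t A w < ereal l}" for l
  have fin: "finite A" using A by (rule finite_subset) simp
  have E_sets: "E l \<in> sets \<nu>" if "l \<in> {0..1}" for l
  proof -
    have "(\<lambda>w. w i) \<in> borel_measurable \<nu>" if "i \<in> A" for i
      unfolding measurable_cong_sets[OF nu(2) refl]
      using A that by (intro measurable_component_singleton) auto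
    from pred_min_stat_less[OF T fin that this] show ?thesis
      unfolding E_def by (simp add: pred_def)
  qed
  have E_mono: "E l \<subseteq> E l'" if "l \<le> l'" for l l'
    using that unfolding E_def by (auto elim: less_le_trans)
  have zero: "measure \<nu> (E 0) \<le> \<alpha>"
  proof -
    have "E 0 = {}" unfolding E_def using min_stat_less_0[OF T] by blast
    then show ?thesis using \<alpha> by simp
  qed
  have down: "measure \<nu> (E l) \<le> \<alpha>" if "0 \<le> l" "l \<le> l'" "l' \<le> 1" "measure \<nu> (E l') \<le> \<alpha>" for l l'
    using finite_measure_mono[OF E_mono[OF that(2)] E_sets[of l']] that by auto
  have left: "measure \<nu> (E s) \<le> \<alpha>"
    if s: "0 < s" "s \<le> 1" and less: "\<And>l. 0 \<le> l \<Longrightarrow> l < s \<Longrightarrow> measure \<nu> (E l) \<le> \<alpha>" for s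
  proof -
    \<comment> \<open>Dividing by at least \<open>2\<close> keeps \<open>u\<^sub>n\<close> strictly between \<open>0\<close> and \<open>s\<close>.\<close>
    define u where "u n = s - s / (real n + 2)" for n
    have u: "0 < u n" "u n < s" for n
      using s(1) by (auto simp: u_def divide_less_eq intro!: add_nonneg_pos)
    have u_lim: "u \<longlonglongrightarrow> s"
      unfolding u_def by real_asymp
    have u_inc: "incseq u"
      unfolding incseq_def u_def using s(1) by (auto intro!: divide_left_mono)
    have E_eq: "E s = (\<Union>n. E (u n))"
    proof
      show "E s \<subseteq> (\<Union>n. E (u n))"
      proof
        fix w assume w: "w \<in> E s"
        then obtain l where l: "min_stat K t A w < ereal l" "l < s"
          unfolding E_def using ereal_dense2[of "min_stat K t A w" "ereal s"] by auto
        have "\<forall>\<^sub>F n in sequentially. l < u n" using order_tendstoD(1)[OF u_lim l(2)] .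
        then obtain n where "l < u n" by (auto simp: eventually_sequentially)
        then have "min_stat K t A w < ereal (u n)"
          using l(1) by (auto elim: less_trans)
        then show "w \<in> (\<Union>n. E (u n))" using w by (auto simp: E_def)
      qed
      show "(\<Union>n. E (u n)) \<subseteq> E s" using E_mono[OF less_imp_le[OF u(2)]] by blast
    qed
    have "(\<lambda>n. measure \<nu> (E (u n))) \<longlonglongrightarrow> measure \<nu> (\<Union>n. E (u n))"
    proof (rule finite_Lim_measure_incseq)
      show "range (\<lambda>n. E (u n)) \<subseteq> sets \<nu>"
      proof (intro image_subsetI E_sets)
        show "u n \<in> {0..1}" for n using u[of n] s(2) by simp
      qed
      show "incseq (\<lambda>n. E (u n))" using u_inc E_mono by (auto simp: incseq_def)
    qed
    then show ?thesis
      unfolding E_eq by (rule LIMSEQ_le_const2) (use less u in \<open>auto intro: less_imp_le\<close>)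
  qed
  have lam: "lambda_nu \<nu> K t \<alpha> A = (GREATEST l. l \<in> {0..1} \<and> measure \<nu> (E l) \<le> \<alpha>)"
    unfolding lambda_nu_def E_def ..
  show "lambda_nu \<nu> K t \<alpha> A \<in> {0..1}"
    unfolding lam
    by (rule Greatest_unit_interval(1)[of "\<lambda>l. measure \<nu> (E l) \<le> \<alpha>"]) (fact zero down left)+
  show "measure \<nu> {w \<in> space \<nu>. min_stat K t A w < ereal l} \<le> \<alpha> \<longleftrightarrow> l \<le> lambda_nu \<nu> K t \<alpha> A"
    if "l \<in> {0..1}"
    unfolding lam E_def[symmetric]
    by (rule Greatest_unit_interval(2)[of "\<lambda>l. measure \<nu> (E l) \<le> \<alpha>"]) (fact zero down left that)+
qed

lemma lambda_nu_antimono: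
  fixes \<nu> :: "(nat \<Rightarrow> real) measure"
  assumes nu: "prob_space \<nu>" "sets \<nu> = sets (\<Pi>\<^sub>M i\<in>{1..m}. borel)"
    and T: "is_template K t" and A: "A \<subseteq> A'" "A' \<subseteq> {1..m}" and \<alpha>: "0 \<le> \<alpha>"
  shows "lambda_nu \<nu> K t \<alpha> A' \<le> lambda_nu \<nu> K t \<alpha> A"
proof -
  interpret prob_space \<nu> by fact
  define l where "l = lambda_nu \<nu> K t \<alpha> A'"
  have A1: "A \<subseteq> {1..m}" and fin: "finite A'" using A by (auto intro: finite_subset)
  have l: "l \<in> {0..1}" unfolding l_def by (rule lambda_nu_props(1)[OF nu T A(2) \<alpha>])
  have sets: "{w \<in> space \<nu>. min_stat K t A' w < ereal l} \<in> sets \<nu>"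
  proof -
    have "(\<lambda>w. w i) \<in> borel_measurable \<nu>" if "i \<in> A'" for i
      unfolding measurable_cong_sets[OF nu(2) refl]
      using A that by (intro measurable_component_singleton) auto
    from pred_min_stat_less[OF T fin l this] show ?thesis by (simp add: pred_def)
  qed
  have "measure \<nu> {w \<in> space \<nu>. min_stat K t A w < ereal l} \<le>
      measure \<nu> {w \<in> space \<nu>. min_stat K t A' w < ereal l}"
    using min_stat_less_mono[OF T A(1) fin] l by (intro finite_measure_mono sets) auto
  also have "\<dots> \<le> \<alpha>"
    using lambda_nu_props(2)[OF nu T A(2) \<alpha> l] by (simp add: l_def)
  finally show ?thesis
    using lambda_nu_props(2)[OF nu T A1 \<alpha> l] by (simp add: l_def)
qed

section \<open>The step-down procedure\<close>

lemma step_down_set_subset: "step_down_set m p t l \<alpha> x j \<subseteq> {1..m}"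
  by (cases j) auto

text \<open>
  An index of \<open>A\<close> can only be discarded if its variable lies below \<open>t\<^sub>1\<close> at the current level, which
  is at most the level of \<open>A\<close>; this is the case \<open>k = 1\<close> of the excluded event. The
  conclusion holds for every iterate, hence for the output irrespective of the stopping time.
\<close>

lemma step_down_set_superset:
  assumes T: "is_template K t" "1 \<le> K" and A: "A \<subseteq> {1..m}"
    and pos: "\<And>i. i \<in> A \<Longrightarrow> 0 \<le> p i x"
    and l: "\<And>B. B \<subseteq> {1..m} \<Longrightarrow> l \<alpha> B x \<in> {0..1}"
    and anti: "\<And>B. A \<subseteq> B \<Longrightarrow> B \<subseteq> {1..m} \<Longrightarrow> l \<alpha> B x \<le> l \<alpha> A x"
    and good: "\<not> min_stat K t A (\<lambda>i. p i x) < ereal (l \<alpha> A x)"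
  shows "A \<subseteq> step_down_set m p t l \<alpha> x j"
proof (induction j)
  case (Suc j)
  define B where "B = step_down_set m p t l \<alpha> x j"
  have B: "A \<subseteq> B" "B \<subseteq> {1..m}"
    using Suc step_down_set_subset[of m p t l \<alpha> x j] unfolding B_def by auto
  have fin: "finite A" using A by (rule finite_subset) simp
  have "t 1 (l \<alpha> B x) \<le> p i x" if i: "i \<in> A" for i
  proof (rule ccontr)
    assume "\<not> t 1 (l \<alpha> B x) \<le> p i x"
    then have "{i} \<subseteq> {i \<in> A. p i x < t 1 (l \<alpha> B x)}" using i by auto
    from card_mono[OF _ this] have "1 \<le> card {i \<in> A. p i x < t 1 (l \<alpha> B x)}" using fin by simp
    then have "min_stat K t A (\<lambda>i. p i x) < ereal (l \<alpha> A x)"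
      using many_small_imp_min_stat_less[OF T(1) fin _ anti[OF B] _ pos, where k = 1] T(2)
        l[OF B(2)] l[OF A] by auto
    with good show False ..
  qed
  then show ?case using A unfolding B_def by auto
qed (use A in simp)

lemma pred_step_down_set_eq:
  assumes p: "\<And>i. i \<in> {1..m} \<Longrightarrow> p i \<in> borel_measurable M"
  shows "Measurable.pred M (\<lambda>x. step_down_set m p t (\<lambda>\<alpha> A x. c \<alpha> A) \<alpha> x j = B)"
proof (induction j arbitrary: B)
  case (Suc j)
  let ?S = "\<lambda>x. step_down_set m p t (\<lambda>\<alpha> A x. c \<alpha> A) \<alpha> x j"
  have "step_down_set m p t (\<lambda>\<alpha> A x. c \<alpha> A) \<alpha> x (Suc j) = B \<longleftrightarrow>
      (\<exists>C\<in>Pow {1..m}. ?S x = C \<and> B \<subseteq> {1..m} \<and> (\<forall>i\<in>{1..m}. i \<in> B \<longleftrightarrow> t 1 (c \<alpha> C) \<le> p i x))" for x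
    using step_down_set_subset[of m p t "\<lambda>\<alpha> A x. c \<alpha> A" \<alpha> x j] by auto
  moreover have "Measurable.pred M (\<lambda>x. \<exists>C\<in>Pow {1..m}. ?S x = C \<and> B \<subseteq> {1..m} \<and>
      (\<forall>i\<in>{1..m}. i \<in> B \<longleftrightarrow> t 1 (c \<alpha> C) \<le> p i x))"
  proof (intro pred_intros_finite(4) pred_intros_logic(3) Suc.IH pred_intros_finite(3))
    fix i and C :: "nat set" assume "i \<in> {1..m}"
    note [measurable] = p[OF this]
    show "Measurable.pred M (\<lambda>x. i \<in> B \<longleftrightarrow> t 1 (c \<alpha> C) \<le> p i x)" by measurable
  qed auto
  ultimately show ?case by presburger
qed simp

lemma pred_step_down_eq:
  assumes p: "\<And>i. i \<in> {1..m} \<Longrightarrow> p i \<in> borel_measurable M"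
  shows "Measurable.pred M (\<lambda>x. step_down m p t (\<lambda>\<alpha> A x. c \<alpha> A) \<alpha> x = B)"
proof -
  let ?S = "\<lambda>j x. step_down_set m p t (\<lambda>\<alpha> A x. c \<alpha> A) \<alpha> x j"
  note [measurable] = pred_step_down_set_eq[where p = p, OF p]
  have "?S j x = ?S (j - 1) x \<longleftrightarrow> (\<exists>C\<in>Pow {1..m}. ?S j x = C \<and> ?S (j - 1) x = C)" for j x
    using step_down_set_subset[of m p t "\<lambda>\<alpha> A x. c \<alpha> A" \<alpha> x j] by auto
  moreover have "Measurable.pred M (\<lambda>x. \<exists>C\<in>Pow {1..m}. ?S j x = C \<and> ?S (j - 1) x = C)" for j
    by (intro pred_intros_finite(4)) auto
  ultimately have [measurable]: "Measurable.pred M (\<lambda>x. ?S j x = ?S (j - 1) x)" for j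
    by presburger
  have [measurable]: "(\<lambda>x. LEAST j. 1 \<le> j \<and> ?S j x = ?S (j - 1) x) \<in> M \<rightarrow>\<^sub>M count_space UNIV"
    by measurable
  show ?thesis
    unfolding step_down_def
    by (rule measurable_compose_countable[where f = "\<lambda>j x. ?S j x = B"]) measurable
qed

section \<open>Control of the joint error rate\<close>

text \<open>
  Let the minimum statistic of the true nulls fall below \<open>L\<close> with probability at most \<open>\<alpha>\<close>. A random
  level that is at most \<open>L\<close> outside this event controls the error rate at \<open>\<alpha>\<close>. The level is taken of
  the form \<open>c(B(x))\<close> for a measurable random subset \<open>B\<close> of \<open>{1..m}\<close>: it then has finitely many values,
  which makes the no-error event measurable.
\<close>

lemma JER_le:
  assumes P: "prob_space P" and T: "is_template K t"
    and p: "\<And>i. i \<in> {1..m} \<Longrightarrow> p i \<in> borel_measurable P"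
    and pos: "\<And>i x. i \<in> {1..m} \<Longrightarrow> x \<in> space P \<Longrightarrow> 0 \<le> p i x"
    and A: "A = true_nulls m H P" and L: "L \<in> {0..1}"
    and bound: "measure P {x \<in> space P. min_stat K t A (\<lambda>i. p i x) < ereal L} \<le> \<alpha>"
    and B: "\<And>C. Measurable.pred P (\<lambda>x. B x = C)" "\<And>x. B x \<subseteq> {1..m}"
    and c: "\<And>C. C \<subseteq> {1..m} \<Longrightarrow> 0 \<le> c C"
    and le: "\<And>x. x \<in> space P \<Longrightarrow> \<not> min_stat K t A (\<lambda>i. p i x) < ereal L \<Longrightarrow> c (B x) \<le> L"
  shows "JER m H K (ref_family m p t (\<lambda>x. c (B x))) P \<le> \<alpha>"
proof -
  interpret prob_space P by fact
  have Am: "A \<subseteq> {1..m}" unfolding A true_nulls_def by auto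
  then have fin: "finite A" by (rule finite_subset) simp
  define bad where "bad = {x \<in> space P. min_stat K t A (\<lambda>i. p i x) < ereal L}"
  define ok where "ok = {x \<in> space P. \<forall>k\<in>{1..K}. card {i \<in> A. p i x < t k (c (B x))} \<le> k - 1}"
  have R: "ref_family m p t (\<lambda>x. c (B x)) k x \<inter> A = {i \<in> A. p i x < t k (c (B x))}" for k x
    unfolding ref_family_def using Am by auto
  have JER: "JER m H K (ref_family m p t (\<lambda>x. c (B x))) P = 1 - measure P ok"
    unfolding JER_def ok_def A[symmetric] R ..
  have ok_iff: "(\<forall>k\<in>{1..K}. card (F k) \<le> k - 1) \<longleftrightarrow> (\<forall>k\<in>{1..K}. \<not> k \<le> card (F k))"
    for F :: "nat \<Rightarrow> nat set"
    by (intro ball_cong) auto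
  have bad_sets: "bad \<in> sets P"
    using pred_min_stat_less[OF T fin L, of "\<lambda>x i. p i x" P] p Am
    unfolding bad_def pred_def by blast
  have ok_sets: "ok \<in> sets P"
  proof -
    have "(\<forall>k\<in>{1..K}. card {i \<in> A. p i x < t k (c (B x))} \<le> k - 1) \<longleftrightarrow>
        (\<exists>C\<in>Pow {1..m}. B x = C \<and> (\<forall>k\<in>{1..K}. \<not> k \<le> card {i \<in> A. p i x < t k (c C)}))" for x
      unfolding ok_iff using B(2)[of x] by blast
    moreover have "Measurable.pred P (\<lambda>x. \<exists>C\<in>Pow {1..m}. B x = C \<and>
        (\<forall>k\<in>{1..K}. \<not> k \<le> card {i \<in> A. p i x < t k (c C)}))"
    proof (intro pred_intros_finite(4) pred_intros_logic B(1) pred_intros_finite(3) pred_le_card fin)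
      fix i k C assume "i \<in> A"
      then have [measurable]: "p i \<in> borel_measurable P" using p Am by auto
      show "Measurable.pred P (\<lambda>x. p i x < t k (c C))" by measurable
    qed auto
    ultimately show ?thesis unfolding ok_def pred_def by presburger
  qed
  have "space P - bad \<subseteq> ok"
  proof
    fix x assume x: "x \<in> space P - bad"
    then have good: "\<not> min_stat K t A (\<lambda>i. p i x) < ereal L" by (auto simp: bad_def)
    have "\<not> k \<le> card {i \<in> A. p i x < t k (c (B x))}" if k: "k \<in> {1..K}" for k
    proof
      assume "k \<le> card {i \<in> A. p i x < t k (c (B x))}"
      from many_small_imp_min_stat_less[OF T fin c[OF B(2)] le[OF _ good] _ _ k this]
      have "min_stat K t A (\<lambda>i. p i x) < ereal L"
        using x L pos[OF subsetD[OF Am]] by auto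
      with good show False ..
    qed
    then show "x \<in> ok" unfolding ok_def ok_iff using x by blast
  qed
  then have "measure P (space P - bad) \<le> measure P ok"
    using ok_sets by (rule finite_measure_mono)
  then have "1 - measure P bad \<le> measure P ok"
    using prob_compl[OF bad_sets] by simp
  then show ?thesis using JER bound unfolding bad_def[symmetric] by simp
qed

theorem theorem5p7:
  fixes S :: "'x measure"
    and \<P> :: "'x measure set"
    and m K :: nat
    and H :: "nat \<Rightarrow> 'x measure set"
    and p :: "nat \<Rightarrow> 'x \<Rightarrow> real"
    and q :: "'x measure \<Rightarrow> nat \<Rightarrow> 'x \<Rightarrow> real"
    and \<nu> :: "(nat \<Rightarrow> real) measure"
    and t :: "nat \<Rightarrow> real \<Rightarrow> real"
  assumes model: "\<And>P. P \<in> \<P> \<Longrightarrow> prob_space P \<and> sets P = sets S"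
    and nulls: "\<And>i. i \<in> {1..m} \<Longrightarrow> H i \<subseteq> \<P>"
    and p_meas: "\<And>i. i \<in> {1..m} \<Longrightarrow> p i \<in> borel_measurable S"
    and p_range: "\<And>i x. i \<in> {1..m} \<Longrightarrow> x \<in> space S \<Longrightarrow> p i x \<in> {0..1}"
    and q_meas: "\<And>P i. P \<in> \<P> \<Longrightarrow> i \<in> {1..m} \<Longrightarrow> q P i \<in> borel_measurable S"
    and q_le_p: "\<And>P i. P \<in> \<P> \<Longrightarrow> i \<in> true_nulls m H P \<Longrightarrow> AE x in P. p i x \<ge> q P i x"
    and nu_prob: "prob_space \<nu>" "sets \<nu> = sets (\<Pi>\<^sub>M i\<in>{1..m}. borel)"
    and q_law: "\<And>P. P \<in> \<P> \<Longrightarrow> joint_law m (q P) P = \<nu>"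
    and K: "K \<in> {1..m}"
    and template: "is_template K t"
  shows "lambda_calibration S \<P> m H p K t (\<lambda>\<alpha> A x. lambda_nu \<nu> K t \<alpha> A)
    \<and> (\<forall>\<alpha>\<in>{0<..<1}. \<forall>P\<in>\<P>.
         JER m H K (ref_family m p t (\<lambda>x. lambda_nu \<nu> K t \<alpha> {1..m})) P \<le> \<alpha>
       \<and> JER m H K (ref_family m p t
           (\<lambda>x. lambda_nu \<nu> K t \<alpha> (step_down m p t (\<lambda>\<alpha> A x. lambda_nu \<nu> K t \<alpha> A) \<alpha> x))) P \<le> \<alpha>)"
proof -
  define lam where "lam = lambda_nu \<nu> K t"
  have lam01: "lam \<alpha> A \<in> {0..1}" if "\<alpha> \<in> {0<..<1}" "A \<subseteq> {1..m}" for \<alpha> A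
    unfolding lam_def using that by (intro lambda_nu_props(1)[OF nu_prob template]) auto
  have lam_anti: "lam \<alpha> A' \<le> lam \<alpha> A" if "\<alpha> \<in> {0<..<1}" "A \<subseteq> A'" "A' \<subseteq> {1..m}" for \<alpha> A A'
    unfolding lam_def using that by (intro lambda_nu_antimono[OF nu_prob template]) auto
  have nulls_sub: "true_nulls m H P \<subseteq> {1..m}" for P
    unfolding true_nulls_def by auto
  have space: "space P = space S" if "P \<in> \<P>" for P
    using model[OF that] sets_eq_imp_space_eq by blast
  have meas_eq: "borel_measurable P = (borel_measurable S :: ('x \<Rightarrow> real) set)" if "P \<in> \<P>" for P
    using model[OF that] by (intro measurable_cong_sets) auto
  have calib: "measure P {x \<in> space P. min_stat K t (true_nulls m H P) (\<lambda>i. p i x)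
      < ereal (lam \<alpha> (true_nulls m H P))} \<le> \<alpha>" if \<alpha>: "\<alpha> \<in> {0<..<1}" and P: "P \<in> \<P>" for \<alpha> P
  proof -
    interpret prob_space P using model[OF P] by simp
    define A where "A = true_nulls m H P"
    define L where "L = lam \<alpha> A"
    define E where "E = {w \<in> space \<nu>. min_stat K t A w < ereal L}"
    define Q where "Q = (\<lambda>x. \<lambda>i\<in>{1..m}. q P i x)"
    have Am: "A \<subseteq> {1..m}" using nulls_sub by (simp add: A_def)
    then have fin: "finite A" by (rule finite_subset) simp
    have L: "L \<in> {0..1}" unfolding L_def by (rule lam01[OF \<alpha> Am])
    have q: "q P i \<in> borel_measurable P" if "i \<in> {1..m}" for i
      using q_meas[OF P that] meas_eq[OF P] by simp
    have pm: "p i \<in> borel_measurable P" if "i \<in> {1..m}" for i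
      using p_meas[OF that] meas_eq[OF P] by simp
    have Q: "Q \<in> P \<rightarrow>\<^sub>M (\<Pi>\<^sub>M i\<in>{1..m}. borel)"
      unfolding Q_def by (intro measurable_restrict q)
    have nu_space: "space \<nu> = space (\<Pi>\<^sub>M i\<in>{1..m}. borel :: real measure)"
      using nu_prob(2) by (rule sets_eq_imp_space_eq)
    have E_sets: "E \<in> sets (\<Pi>\<^sub>M i\<in>{1..m}. borel)"
    proof -
      have "(\<lambda>w. w i) \<in> borel_measurable (\<Pi>\<^sub>M i\<in>{1..m}. borel :: real measure)" if "i \<in> A" for i
        using Am that by (intro measurable_component_singleton) auto
      from pred_min_stat_less[OF template fin L this] show ?thesis
        unfolding E_def nu_space by (simp add: pred_def)
    qed
    have min_Q: "min_stat K t A (Q x) < ereal L"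
      if "min_stat K t A (\<lambda>i. p i x) < ereal L" "\<forall>i\<in>A. q P i x \<le> p i x" for x
      by (rule min_stat_less_mono[OF template order_refl fin _ _ _ that(1)])
        (use that(2) L Am in \<open>auto simp: Q_def\<close>)
    have "AE x in P. \<forall>i\<in>A. q P i x \<le> p i x"
      using q_le_p[OF P] fin by (intro AE_finite_allI) (auto simp: A_def)
    then have "AE x in P. x \<in> {x \<in> space P. min_stat K t A (\<lambda>i. p i x) < ereal L} \<longrightarrow>
        x \<in> Q -` E \<inter> space P"
      using AE_space
    proof eventually_elim
      case (elim x)
      then show ?case
        using min_Q[of x] measurable_space[OF Q, of x] by (auto simp: E_def nu_space)
    qed
    then have "measure P {x \<in> space P. min_stat K t A (\<lambda>i. p i x) < ereal L} \<le>
        measure P (Q -` E \<inter> space P)"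
      by (rule finite_measure_mono_AE) (rule measurable_sets[OF Q E_sets])
    also have "\<dots> = measure (joint_law m (q P) P) E"
      unfolding joint_law_def Q_def[symmetric] by (rule measure_distr[OF Q E_sets, symmetric])
    also have "\<dots> \<le> \<alpha>"
      using lambda_nu_props(2)[OF nu_prob template Am _ L, of \<alpha>] \<alpha>
      by (simp add: q_law[OF P] E_def L_def lam_def)
    finally show ?thesis unfolding L_def A_def .
  qed
  have "lambda_calibration S \<P> m H p K t (\<lambda>\<alpha> A x. lam \<alpha> A)"
    unfolding lambda_calibration_def using lam01 lam_anti calib by simp
  moreover have
    "JER m H K (ref_family m p t (\<lambda>x. lam \<alpha> {1..m})) P \<le> \<alpha>"
    "JER m H K (ref_family m p t (\<lambda>x. lam \<alpha> (step_down m p t (\<lambda>\<alpha> A x. lam \<alpha> A) \<alpha> x))) P \<le> \<alpha>"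
    if \<alpha>: "\<alpha> \<in> {0<..<1}" and P: "P \<in> \<P>" for \<alpha> P
  proof -
    have pm: "p i \<in> borel_measurable P" if "i \<in> {1..m}" for i
      using p_meas[OF that] meas_eq[OF P] by simp
    have pos: "0 \<le> p i x" if "i \<in> {1..m}" "x \<in> space P" for i x
      using p_range[OF that(1)] that(2) space[OF P] by auto
    have lam_nonneg: "0 \<le> lam \<alpha> C" if "C \<subseteq> {1..m}" for C
      using lam01[OF \<alpha> that] by simp
    have prob: "prob_space P" using model[OF P] by simp
    note JER = JER_le[where c = "lam \<alpha>" and p = p, OF prob template pm pos refl
        lam01[OF \<alpha> nulls_sub] calib[OF \<alpha> P] _ _ lam_nonneg]
    show "JER m H K (ref_family m p t (\<lambda>x. lam \<alpha> {1..m})) P \<le> \<alpha>"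
      using lam_anti[OF \<alpha> nulls_sub] by (intro JER) auto
    show "JER m H K (ref_family m p t
        (\<lambda>x. lam \<alpha> (step_down m p t (\<lambda>\<alpha> A x. lam \<alpha> A) \<alpha> x))) P \<le> \<alpha>"
    proof (rule JER)
      show "Measurable.pred P (\<lambda>x. step_down m p t (\<lambda>\<alpha> A x. lam \<alpha> A) \<alpha> x = C)" for C
        by (intro pred_step_down_eq pm)
      show sub: "step_down m p t (\<lambda>\<alpha> A x. lam \<alpha> A) \<alpha> x \<subseteq> {1..m}" for x
        unfolding step_down_def by (rule step_down_set_subset)
      fix x
      assume x: "x \<in> space P" and good: "\<not> min_stat K t (true_nulls m H P) (\<lambda>i. p i x)
        < ereal (lam \<alpha> (true_nulls m H P))"
      have "true_nulls m H P \<subseteq> step_down m p t (\<lambda>\<alpha> A x. lam \<alpha> A) \<alpha> x"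
        unfolding step_down_def
      proof (rule step_down_set_superset[OF template _ nulls_sub])
        show "0 \<le> p i x" if "i \<in> true_nulls m H P" for i
          using pos[OF _ x] nulls_sub that by blast
      qed (use K lam01[OF \<alpha>] lam_anti[OF \<alpha>] good in auto)
      then show "lam \<alpha> (step_down m p t (\<lambda>\<alpha> A x. lam \<alpha> A) \<alpha> x) \<le> lam \<alpha> (true_nulls m H P)"
        using lam_anti[OF \<alpha> _ sub] by blast
    qed auto
  qed
  ultimately show ?thesis unfolding lam_def by blast
qed

end
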